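(* Let $\mathcal{D}$ be a set of distributions of $(\boldsymbol\zeta,\boldsymbol\xi)$, $\mathcal{H}\subseteq\{\boldsymbol x:\mathbb{R}^{n_\zeta}\to\mathcal{X}\}$, and suppose $\bar{\boldsymbol x}\in\mathcal{H}$ (as a constant policy). Then the problem $$(DRPCR)\qquad \max_{\boldsymbol x(\cdot)\in\mathcal{H}}\ \mathcal{V}_{\mathcal{D}}(\boldsymbol x(\cdot),\bar{\boldsymbol x})$$ is equivalent (same optimal value and same optimal policies $\boldsymbol x(\cdot)$) to the problem $$\max_{\boldsymbol x(\cdot)\in\mathcal{H},\,\gamma}\ \gamma\quad\text{subject to}\quad Q(\boldsymbol x(\cdot),\gamma)\le 0,\quad 0\le\gamma\le 1,\qquad (\ast)$$ where $$Q(\boldsymbol x(\cdot),\gamma):=\sup_{F\in\mathcal{D}}\ \mathbb{E}_F\Big[h(\boldsymbol x(\boldsymbol\zeta),\boldsymbol\xi)-\Big((1-\gamma)h(\bar{\boldsymbol x},\boldsymbol\xi)+\gamma\min_{\boldsymbol x'\in\mathcal{X}}h(\boldsymbol x',\boldsymbol\xi)\Big)\Big]$$ is a convex non-decreasing function of $\gamma$. Moreover, problem $(\ast)$ is a convex optimization problem when $\mathcal{H}$ is convex.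
   Context: Setting: $\mathcal{X}\subseteq\mathbb{R}^{n_x}$ is a convex feasible set; $h(\boldsymbol x,\boldsymbol\xi)$ is a real-valued cost function, convex in $\boldsymbol x$ for all $\boldsymbol\xi$; $\boldsymbol\xi\in\mathbb{R}^{n_\xi}$ is a random vector and $\boldsymbol\zeta\in\mathbb{R}^{n_\zeta}$ a random vector of covariates; $F$ denotes a joint distribution of $(\boldsymbol\zeta,\boldsymbol\xi)$ and $\mathbb{E}_F$ the expectation under $F$. Conventions: $\mathcal{D}$ is nonempty; for each $\boldsymbol\xi$ the minimum $\min_{\boldsymbol x'\in\mathcal{X}}h(\boldsymbol x',\boldsymbol\xi)$ exists; all expectations that appear are well defined and finite. Prescriptiveness competitive ratio (PCR) of a policy $\boldsymbol x(\cdot)$ with respect to $\bar{\boldsymbol x}$ under $F$: writing $m_F:=\mathbb{E}_F[\min_{\boldsymbol x'\in\mathcal{X}}h(\boldsymbol x',\boldsymbol\xi)]$, $$\mathcal{V}_F(\boldsymbol x(\cdot),\bar{\boldsymbol x}):=\begin{cases}1-\dfrac{\mathbb{E}_F[h(\boldsymbol x(\boldsymbol\zeta),\boldsymbol\xi)]-m_F}{\mathbb{E}_F[h(\bar{\boldsymbol x},\boldsymbol\xi)]-m_F} & \text{if } \mathbb{E}_F[h(\bar{\boldsymbol x},\boldsymbol\xi)]-m_F>0,\\ 1 & \text{if } \mathbb{E}_F[h(\bar{\boldsymbol x},\boldsymbol\xi)]=m_F \text{ and } \mathbb{E}_F[h(\boldsymbol x(\boldsymbol\zeta),\boldsymbol\xi)]=m_F,\\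 -\infty & \text{otherwise.}\end{cases}$$ Distributionally robust PCR: $\mathcal{V}_{\mathcal{D}}(\boldsymbol x(\cdot),\bar{\boldsymbol x}):=\inf_{F\in\mathcal{D}}\mathcal{V}_F(\boldsymbol x(\cdot),\bar{\boldsymbol x})$. "Convex optimization problem" means that the (linear) objective is maximized over a convex feasible set of pairs $(\boldsymbol x(\cdot),\gamma)$ described by convex constraints ($Q$ jointly convex in $(\boldsymbol x(\cdot),\gamma)$). *)

theory Defs
  imports "HOL-Probability.Probability" "HOL-Library.Function_Algebras"
begin

text \<open>
  Pointwise vector space structure on functions, so that \<^const>\<open>convex\<close> applies to sets of
  policies and of pairs of a policy and a real number.
\<close>

instantiation "fun" :: (type, real_vector) real_vector
begin

definition scaleR_fun :: "real \<Rightarrow> ('a \<Rightarrow> 'b) \<Rightarrow> 'a \<Rightarrow> 'b"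
  where "scaleR_fun r f = (\<lambda>x. r *\<^sub>R f x)"

instance
  by standard
    (simp_all add: scaleR_fun_def plus_fun_def fun_eq_iff scaleR_add_right scaleR_add_left)

end

text \<open>
  The extended-real counterpart of \<^const>\<open>convex_on\<close>. With the conventions
  \<open>0 * \<plusminus>\<infinity> = 0\<close> and \<open>\<infinity> + (-\<infinity>) = \<infinity>\<close> of \<^typ>\<open>ereal\<close>, this is
  convexity of the epigraph.
\<close>

definition ereal_convex_on :: "'a::real_vector set \<Rightarrow> ('a \<Rightarrow> ereal) \<Rightarrow> bool"
  where "ereal_convex_on S f \<longleftrightarrow> convex S \<and>
    (\<forall>x\<in>S. \<forall>y\<in>S. \<forall>u\<ge>0. \<forall>v\<ge>0. u + v = 1 \<longrightarrow>
      f (u *\<^sub>R x + v *\<^sub>R y) \<le> ereal u * f x + ereal v * f y)"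

text \<open>
  The minimum as the least element of the set of costs; meaningful only if it is attained.
\<close>

definition min_cost :: "'x set \<Rightarrow> ('x \<Rightarrow> 's \<Rightarrow> real) \<Rightarrow> 's \<Rightarrow> real"
  where "min_cost X h \<xi> = (LEAST c. c \<in> (\<lambda>x'. h x' \<xi>) ` X)"

text \<open>
  Measures \<open>F\<close> are joint distributions of pairs \<open>(\<zeta>, \<xi>)\<close> of covariates and random parameters.
\<close>

definition pcr ::
  "'x set \<Rightarrow> ('x \<Rightarrow> 's \<Rightarrow> real) \<Rightarrow> ('z \<times> 's) measure \<Rightarrow> ('z \<Rightarrow> 'x) \<Rightarrow> 'x \<Rightarrow> ereal"
  where "pcr X h F x xbar =
    (let m = (\<integral>(\<zeta>, \<xi>). min_cost X h \<xi> \<partial>F);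
         c = (\<integral>(\<zeta>, \<xi>). h (x \<zeta>) \<xi> \<partial>F);
         cbar = (\<integral>(\<zeta>, \<xi>). h xbar \<xi> \<partial>F)
     in if cbar - m > 0 then ereal (1 - (c - m) / (cbar - m))
        else if cbar = m \<and> c = m then 1
        else - \<infinity>)"

definition dr_pcr ::
  "'x set \<Rightarrow> ('x \<Rightarrow> 's \<Rightarrow> real) \<Rightarrow> ('z \<times> 's) measure set \<Rightarrow> ('z \<Rightarrow> 'x) \<Rightarrow> 'x \<Rightarrow> ereal"
  where "dr_pcr X h D x xbar = (INF F\<in>D. pcr X h F x xbar)"

definition worst_regret ::
  "'x set \<Rightarrow> ('x \<Rightarrow> 's \<Rightarrow> real) \<Rightarrow> ('z \<times> 's) measure set \<Rightarrow> 'x \<Rightarrow> ('z \<Rightarrow> 'x) \<Rightarrow> real \<Rightarrow> ereal"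
  where "worst_regret X h D xbar x \<gamma> =
    (SUP F\<in>D. ereal (\<integral>(\<zeta>, \<xi>).
       h (x \<zeta>) \<xi> - ((1 - \<gamma>) * h xbar \<xi> + \<gamma> * min_cost X h \<xi>) \<partial>F))"

definition reform_feasible ::
  "'x set \<Rightarrow> ('x \<Rightarrow> 's \<Rightarrow> real) \<Rightarrow> ('z \<times> 's) measure set \<Rightarrow> ('z \<Rightarrow> 'x) set \<Rightarrow> 'x
    \<Rightarrow> (('z \<Rightarrow> 'x) \<times> real) set"
  where "reform_feasible X h D H xbar =
    {(x, \<gamma>). x \<in> H \<and> worst_regret X h D xbar x \<gamma> \<le> 0 \<and> 0 \<le> \<gamma> \<and> \<gamma> \<le> 1}"

end

theory Submission
  imports Defs
begin

text \<open>
  Fix a policy \<open>x\<close>. For each distribution write \<open>c\<close>, \<open>cbar\<close> and \<open>m\<close> for the expected costs of the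
  policy, of the reference decision and of the wait-and-see minimum. Multiplying the inequality
  \<open>\<gamma> \<le> 1 - (c - m) / (cbar - m)\<close> by \<open>cbar - m > 0\<close> turns it into
  \<open>c - ((1 - \<gamma>) * cbar + \<gamma> * m) \<le> 0\<close>, which is linear in \<open>\<gamma>\<close> and whose left-hand side is the
  expected regret. The two degenerate branches of the competitive ratio are exactly what makes the
  equivalence survive \<open>cbar = m\<close>: the regret inequality then says \<open>c \<le> m\<close>, that is \<open>c = m\<close>, which is
  when the ratio is \<open>1\<close> and not \<open>-\<infinity>\<close> (lemma \<open>le_pcr_iff_expected_regret\<close>). Taking the infimum
  over the distributions on one side and the supremum on the other,
  for \<open>\<gamma> \<le> 1\<close> the worst regret is nonpositive iff \<open>\<gamma>\<close> is at most the distributionally robust ratio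
  (lemma \<open>le_dr_pcr_iff_worst_regret\<close>).

  So the reformulation maximizes over the hypograph of the robust ratio, cut off to
  \<open>0 \<le> \<gamma> \<le> 1\<close>. The cut loses nothing: ratios never exceed \<open>1\<close>, and the constant policy
  \<open>xbar\<close> competes with a ratio of at least \<open>0\<close>, so that policies with a negative ratio are neither
  optimal nor relevant to the optimal value (lemmas \<open>SUP_truncated_hypograph\<close> and
  \<open>arg_max_truncated_hypograph\<close>).

  Convexity holds because the expected regret is, for each distribution, a convex functional of
  the policy plus an affine function of \<open>\<gamma>\<close>, there being no product of \<open>x\<close> and \<open>\<gamma>\<close>; suprema
  preserve convexity (lemma \<open>ereal_convex_on_SUP\<close>). Monotonicity in \<open>\<gamma>\<close> is the inequality
  \<open>m \<le> cbar\<close>.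
\<close>

section \<open>Extended-real convexity\<close>

lemma ereal_convex_on_SUP:
  fixes f :: "'i \<Rightarrow> 'a::real_vector \<Rightarrow> real"
  assumes "convex S" and "\<And>i. i \<in> I \<Longrightarrow> convex_on S (f i)"
  shows "ereal_convex_on S (\<lambda>x. SUP i\<in>I. ereal (f i x))"
  unfolding ereal_convex_on_def
proof (intro conjI ballI allI impI SUP_least)
  fix x y and u v :: real and i
  assume *: "x \<in> S" "y \<in> S" "0 \<le> u" "0 \<le> v" "u + v = 1" "i \<in> I"
  have "f i (u *\<^sub>R x + v *\<^sub>R y) \<le> u * f i x + v * f i y"
    using assms(2)[OF \<open>i \<in> I\<close>] * by (simp add: convex_on_def)
  then have "ereal (f i (u *\<^sub>R x + v *\<^sub>R y)) \<le> ereal u * ereal (f i x) + ereal v * ereal (f i y)"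
    by simp
  also have "\<dots> \<le> ereal u * (SUP i\<in>I. ereal (f i x)) + ereal v * (SUP i\<in>I. ereal (f i y))"
    using * by (intro add_mono ereal_mult_left_mono SUP_upper) auto
  finally show "ereal (f i (u *\<^sub>R x + v *\<^sub>R y))
      \<le> ereal u * (SUP i\<in>I. ereal (f i x)) + ereal v * (SUP i\<in>I. ereal (f i y))" .
qed (rule assms(1))

lemma convex_nonpos_level_set:
  assumes "ereal_convex_on S f"
  shows "convex {x \<in> S. f x \<le> 0}"
proof (rule convexI)
  fix x y and u v :: real
  assume x: "x \<in> {x \<in> S. f x \<le> 0}" and y: "y \<in> {x \<in> S. f x \<le> 0}"
    and uv: "0 \<le> u" "0 \<le> v" "u + v = 1"
  have "u *\<^sub>R x + v *\<^sub>R y \<in> S"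
    using assms x y uv by (auto simp: ereal_convex_on_def intro: convexD)
  moreover have "f (u *\<^sub>R x + v *\<^sub>R y) \<le> ereal u * f x + ereal v * f y"
    using assms x y uv by (simp add: ereal_convex_on_def)
  moreover have "ereal u * f x + ereal v * f y \<le> 0 + 0"
    using ereal_mult_left_mono[of "f x" 0 "ereal u"] ereal_mult_left_mono[of "f y" 0 "ereal v"]
      x y uv by (intro add_mono) auto
  ultimately show "u *\<^sub>R x + v *\<^sub>R y \<in> {x \<in> S. f x \<le> 0}"
    by auto
qed

section \<open>Maximizing over a truncated hypograph\<close>

lemma truncated_hypograph_top:
  fixes d :: "'a \<Rightarrow> ereal"
  assumes "0 \<le> d x" and "d x \<le> 1"
  obtains \<gamma> where "d x = ereal \<gamma>" "0 \<le> \<gamma>" "\<gamma> \<le> 1"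
  using assms by (cases "d x") auto

text \<open>
  A function bounded by \<open>1\<close> that reaches a nonnegative value has the same maximization
  problem as its hypograph over \<open>[0, 1]\<close>: above each point of nonnegative value the fiber of the
  hypograph has the value itself as its largest element, and above the other points it is empty.
\<close>

lemma SUP_truncated_hypograph:
  fixes d :: "'a \<Rightarrow> ereal"
  assumes le1: "\<And>x. x \<in> H \<Longrightarrow> d x \<le> 1" and x0: "x0 \<in> H" "0 \<le> d x0"
  shows "(SUP x\<in>H. d x)
    = (SUP (x, \<gamma>)\<in>{(x, \<gamma>). x \<in> H \<and> ereal \<gamma> \<le> d x \<and> 0 \<le> \<gamma> \<and> \<gamma> \<le> 1}. ereal \<gamma>)"
    (is "_ = (SUP (x, \<gamma>)\<in>?S. ereal \<gamma>)")
proof (rule antisym)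
  have top: "d x \<le> (SUP (x, \<gamma>)\<in>?S. ereal \<gamma>)" if x: "x \<in> H" "0 \<le> d x" for x
  proof -
    obtain \<gamma> where "d x = ereal \<gamma>" "0 \<le> \<gamma>" "\<gamma> \<le> 1"
      using truncated_hypograph_top[of d x] x le1 by blast
    then show ?thesis
      using x by (intro SUP_upper2[where i="(x, \<gamma>)"]) auto
  qed
  show "(SUP x\<in>H. d x) \<le> (SUP (x, \<gamma>)\<in>?S. ereal \<gamma>)"
  proof (rule SUP_least)
    fix x assume "x \<in> H"
    show "d x \<le> (SUP (x, \<gamma>)\<in>?S. ereal \<gamma>)"
    proof (cases "0 \<le> d x")
      case True
      with \<open>x \<in> H\<close> show ?thesis by (rule top)
    next
      case False
      then have "d x \<le> d x0" using x0(2) by auto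
      then show ?thesis using top[OF x0] by (rule order_trans)
    qed
  qed
  show "(SUP (x, \<gamma>)\<in>?S. ereal \<gamma>) \<le> (SUP x\<in>H. d x)"
    by (rule SUP_least) (auto intro: SUP_upper2)
qed

lemma arg_max_truncated_hypograph:
  fixes d :: "'a \<Rightarrow> ereal"
  assumes le1: "\<And>x. x \<in> H \<Longrightarrow> d x \<le> 1" and x0: "x0 \<in> H" "0 \<le> d x0"
  defines "S \<equiv> {(x, \<gamma>). x \<in> H \<and> ereal \<gamma> \<le> d x \<and> 0 \<le> \<gamma> \<and> \<gamma> \<le> 1}"
  shows "is_arg_max d (\<lambda>x. x \<in> H) x
    \<longleftrightarrow> (\<exists>\<gamma>. is_arg_max (\<lambda>(x, \<gamma>). \<gamma>) (\<lambda>p. p \<in> S) (x, \<gamma>))"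
proof
  assume "is_arg_max d (\<lambda>x. x \<in> H) x"
  then have x: "x \<in> H" and max: "\<And>y. y \<in> H \<Longrightarrow> d y \<le> d x"
    by (auto simp: is_arg_max_linorder)
  have "0 \<le> d x"
    using x0(2) max[OF x0(1)] by (rule order_trans)
  then obtain \<gamma> where \<gamma>: "d x = ereal \<gamma>" "0 \<le> \<gamma>" "\<gamma> \<le> 1"
    using truncated_hypograph_top[of d x] le1 x by blast
  have "\<beta> \<le> \<gamma>" if "(y, \<beta>) \<in> S" for y \<beta>
  proof -
    have "ereal \<beta> \<le> d y" "d y \<le> d x"
      using that max by (auto simp: S_def)
    then show ?thesis
      using \<gamma>(1) by (metis ereal_less_eq(3) order_trans)
  qed
  then have "is_arg_max (\<lambda>(x, \<gamma>). \<gamma>) (\<lambda>p. p \<in> S) (x, \<gamma>)"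
    using x \<gamma> by (auto simp: is_arg_max_linorder S_def)
  then show "\<exists>\<gamma>. is_arg_max (\<lambda>(x, \<gamma>). \<gamma>) (\<lambda>p. p \<in> S) (x, \<gamma>)" ..
next
  assume "\<exists>\<gamma>. is_arg_max (\<lambda>(x, \<gamma>). \<gamma>) (\<lambda>p. p \<in> S) (x, \<gamma>)"
  then obtain \<gamma> where x\<gamma>: "(x, \<gamma>) \<in> S" and max: "\<And>y \<beta>. (y, \<beta>) \<in> S \<Longrightarrow> \<beta> \<le> \<gamma>"
    by (auto simp: is_arg_max_linorder)
  then have "ereal \<gamma> \<le> d x" "0 \<le> ereal \<gamma>"
    by (auto simp: S_def)
  moreover have "d y \<le> ereal \<gamma>" if y: "y \<in> H" for y
  proof (cases "0 \<le> d y")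
    case True
    then obtain \<beta> where "d y = ereal \<beta>" "0 \<le> \<beta>" "\<beta> \<le> 1"
      using truncated_hypograph_top[of d y] le1 y by blast
    then show ?thesis
      using max[of y \<beta>] y by (auto simp: S_def)
  next
    case False
    then show ?thesis using \<open>0 \<le> ereal \<gamma>\<close> by (meson linear order_trans)
  qed
  ultimately show "is_arg_max d (\<lambda>x. x \<in> H) x"
    using x\<gamma> by (auto simp: is_arg_max_linorder S_def intro: order_trans)
qed

section \<open>Expected costs\<close>

lemma min_cost_le:
  assumes "\<exists>x\<in>X. \<forall>x'\<in>X. h x \<xi> \<le> h x' \<xi>" and "y \<in> X"
  shows "min_cost X h \<xi> \<le> h y \<xi>"
proof -
  obtain x where x: "x \<in> X" "\<And>x'. x' \<in> X \<Longrightarrow> h x \<xi> \<le> h x' \<xi>"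
    using assms(1) by blast
  then have "min_cost X h \<xi> = h x \<xi>"
    unfolding min_cost_def by (intro Least_equality) auto
  then show ?thesis
    using x assms(2) by simp
qed

definition expected_cost :: "('x \<Rightarrow> 's \<Rightarrow> real) \<Rightarrow> ('z \<times> 's) measure \<Rightarrow> ('z \<Rightarrow> 'x) \<Rightarrow> real"
  where "expected_cost h F x = (\<integral>(\<zeta>, \<xi>). h (x \<zeta>) \<xi> \<partial>F)"

definition expected_min_cost :: "'x set \<Rightarrow> ('x \<Rightarrow> 's \<Rightarrow> real) \<Rightarrow> ('z \<times> 's) measure \<Rightarrow> real"
  where "expected_min_cost X h F = (\<integral>(\<zeta>, \<xi>). min_cost X h \<xi> \<partial>F)"

lemma expected_min_cost_le:
  assumes "\<And>\<xi>. \<exists>x\<in>X. \<forall>x'\<in>X. h x \<xi> \<le> h x' \<xi>" and "\<And>\<zeta>. x \<zeta> \<in> X"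
    and "integrable F (\<lambda>(\<zeta>, \<xi>). h (x \<zeta>) \<xi>)" and "integrable F (\<lambda>(\<zeta>, \<xi>). min_cost X h \<xi>)"
  shows "expected_min_cost X h F \<le> expected_cost h F x"
  unfolding expected_cost_def expected_min_cost_def
  using assms by (intro integral_mono) (auto intro: min_cost_le)

lemma convex_on_expected_cost:
  fixes H :: "('z \<Rightarrow> 'x::real_vector) set"
  assumes "\<And>\<xi>. convex_on X (\<lambda>x. h x \<xi>)" and "convex H"
    and "\<And>x \<zeta>. x \<in> H \<Longrightarrow> x \<zeta> \<in> X"
    and int: "\<And>x. x \<in> H \<Longrightarrow> integrable F (\<lambda>(\<zeta>, \<xi>). h (x \<zeta>) \<xi>)"
  shows "convex_on H (expected_cost h F)"
  unfolding convex_on_def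
proof (intro conjI ballI allI impI)
  fix x y and u v :: real
  assume *: "x \<in> H" "y \<in> H" "0 \<le> u" "0 \<le> v" "u + v = 1"
  have mem: "u *\<^sub>R x + v *\<^sub>R y \<in> H"
    using \<open>convex H\<close> * by (auto intro: convexD)
  have pointwise: "h ((u *\<^sub>R x + v *\<^sub>R y) \<zeta>) \<xi> \<le> u * h (x \<zeta>) \<xi> + v * h (y \<zeta>) \<xi>" for \<zeta> \<xi>
    using assms(1)[of \<xi>] assms(3) * by (simp add: convex_on_def plus_fun_def scaleR_fun_def)
  have "expected_cost h F (u *\<^sub>R x + v *\<^sub>R y)
      \<le> (\<integral>p. u * (case p of (\<zeta>, \<xi>) \<Rightarrow> h (x \<zeta>) \<xi>) + v * (case p of (\<zeta>, \<xi>) \<Rightarrow> h (y \<zeta>) \<xi>) \<partial>F)"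
    unfolding expected_cost_def
    using int[OF mem] int[OF *(1)] int[OF *(2)] pointwise
    by (intro integral_mono Bochner_Integration.integrable_add integrable_mult_right) auto
  also have "\<dots> = u * expected_cost h F x + v * expected_cost h F y"
    using int[OF *(1)] int[OF *(2)] by (simp add: expected_cost_def)
  finally show "expected_cost h F (u *\<^sub>R x + v *\<^sub>R y)
      \<le> u * expected_cost h F x + v * expected_cost h F y" .
qed (rule assms(2))

section \<open>Regret and the competitive ratio\<close>

definition expected_regret ::
  "'x set \<Rightarrow> ('x \<Rightarrow> 's \<Rightarrow> real) \<Rightarrow> ('z \<times> 's) measure \<Rightarrow> 'x \<Rightarrow> ('z \<Rightarrow> 'x) \<Rightarrow> real \<Rightarrow> real"
  where "expected_regret X h F xbar x \<gamma> = expected_cost h F x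
    - ((1 - \<gamma>) * expected_cost h F (\<lambda>\<zeta>. xbar) + \<gamma> * expected_min_cost X h F)"

lemma worst_regret_eq_SUP:
  assumes "\<And>F. F \<in> D \<Longrightarrow> integrable F (\<lambda>(\<zeta>, \<xi>). h (x \<zeta>) \<xi>)"
    and "\<And>F. F \<in> D \<Longrightarrow> integrable F (\<lambda>(\<zeta>, \<xi>). h xbar \<xi>)"
    and "\<And>F. F \<in> D \<Longrightarrow> integrable F (\<lambda>(\<zeta>, \<xi>). min_cost X h \<xi>)"
  shows "worst_regret X h D xbar x \<gamma> = (SUP F\<in>D. ereal (expected_regret X h F xbar x \<gamma>))"
  unfolding worst_regret_def
proof (rule SUP_cong)
  fix F assume F: "F \<in> D"
  show "ereal (\<integral>(\<zeta>, \<xi>). h (x \<zeta>) \<xi> - ((1 - \<gamma>) * h xbar \<xi> + \<gamma> * min_cost X h \<xi>) \<partial>F)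
      = ereal (expected_regret X h F xbar x \<gamma>)"
    using assms[OF F]
    by (simp add: expected_regret_def expected_cost_def expected_min_cost_def case_prod_beta')
qed simp

lemma pcr_eq:
  "pcr X h F x xbar =
    (let m = expected_min_cost X h F; c = expected_cost h F x; cbar = expected_cost h F (\<lambda>\<zeta>. xbar)
     in if cbar - m > 0 then ereal (1 - (c - m) / (cbar - m))
        else if cbar = m \<and> c = m then 1 else - \<infinity>)"
  by (simp add: pcr_def expected_cost_def expected_min_cost_def)

lemma pcr_le_1:
  assumes "expected_min_cost X h F \<le> expected_cost h F x"
  shows "pcr X h F x xbar \<le> 1"
  using assms by (auto simp: pcr_eq Let_def one_ereal_def)

lemma pcr_reference_nonneg:
  assumes "expected_min_cost X h F \<le> expected_cost h F (\<lambda>\<zeta>. xbar)"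
  shows "0 \<le> pcr X h F (\<lambda>\<zeta>. xbar) xbar"
  using assms by (auto simp: pcr_eq Let_def)

text \<open>
  Clearing the denominator. The bound on \<open>\<gamma>\<close> comes from the degenerate case \<open>cbar = c = m\<close>:
  the regret then vanishes for all \<open>\<gamma>\<close>, whereas the ratio is \<open>1\<close>.
\<close>

lemma le_pcr_iff_expected_regret:
  assumes "expected_min_cost X h F \<le> expected_cost h F x"
    and "expected_min_cost X h F \<le> expected_cost h F (\<lambda>\<zeta>. xbar)"
    and "\<gamma> \<le> 1"
  shows "ereal \<gamma> \<le> pcr X h F x xbar \<longleftrightarrow> expected_regret X h F xbar x \<gamma> \<le> 0"
proof -
  define m c cbar where "m = expected_min_cost X h F" and "c = expected_cost h F x"
    and "cbar = expected_cost h F (\<lambda>\<zeta>. xbar)"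
  note defs = pcr_eq expected_regret_def Let_def m_def[symmetric] c_def[symmetric] cbar_def[symmetric]
  have "m \<le> c" "m \<le> cbar"
    using assms by (simp_all add: defs)
  show ?thesis
  proof (cases "m < cbar")
    case True
    then have "\<gamma> \<le> 1 - (c - m) / (cbar - m) \<longleftrightarrow> (c - m) / (cbar - m) \<le> 1 - \<gamma>"
      by linarith
    also have "\<dots> \<longleftrightarrow> c - m \<le> (1 - \<gamma>) * (cbar - m)"
      using True by (intro pos_divide_le_eq) simp
    also have "\<dots> \<longleftrightarrow> c - ((1 - \<gamma>) * cbar + \<gamma> * m) \<le> 0"
      by (simp add: algebra_simps)
    finally show ?thesis
      using True by (simp add: defs)
  next
    case False
    then have "cbar = m"
      using \<open>m \<le> cbar\<close> by simp
    then show ?thesis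
      using \<open>m \<le> c\<close> \<open>\<gamma> \<le> 1\<close> by (auto simp: defs algebra_simps one_ereal_def)
  qed
qed

lemma le_dr_pcr_iff_worst_regret:
  assumes "\<And>\<xi>. \<exists>x\<in>X. \<forall>x'\<in>X. h x \<xi> \<le> h x' \<xi>" and "\<And>\<zeta>. x \<zeta> \<in> X" and "xbar \<in> X"
    and "\<And>F. F \<in> D \<Longrightarrow> integrable F (\<lambda>(\<zeta>, \<xi>). h (x \<zeta>) \<xi>)"
    and "\<And>F. F \<in> D \<Longrightarrow> integrable F (\<lambda>(\<zeta>, \<xi>). h xbar \<xi>)"
    and "\<And>F. F \<in> D \<Longrightarrow> integrable F (\<lambda>(\<zeta>, \<xi>). min_cost X h \<xi>)"
    and "\<gamma> \<le> 1"
  shows "ereal \<gamma> \<le> dr_pcr X h D x xbar \<longleftrightarrow> worst_regret X h D xbar x \<gamma> \<le> 0"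
proof -
  have "ereal \<gamma> \<le> pcr X h F x xbar \<longleftrightarrow> expected_regret X h F xbar x \<gamma> \<le> 0" if F: "F \<in> D" for F
    using assms F by (intro le_pcr_iff_expected_regret expected_min_cost_le) auto
  then show ?thesis
    using assms by (simp add: dr_pcr_def le_INF_iff SUP_le_iff worst_regret_eq_SUP)
qed

lemma dr_pcr_le_1:
  assumes "D \<noteq> {}" and "\<And>F. F \<in> D \<Longrightarrow> expected_min_cost X h F \<le> expected_cost h F x"
  shows "dr_pcr X h D x xbar \<le> 1"
proof -
  obtain F where "F \<in> D" using assms(1) by blast
  then show ?thesis
    unfolding dr_pcr_def using assms(2) by (intro INF_lower2[of F] pcr_le_1)
qed

section \<open>Dependence of the worst regret on the policy and the ratio\<close>

lemma convex_on_expected_regret: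
  assumes "convex_on H (expected_cost h F)"
  shows "convex_on (H \<times> UNIV) (\<lambda>(x, \<gamma>). expected_regret X h F xbar x \<gamma>)"
  unfolding convex_on_def
proof (intro conjI ballI allI impI)
  show "convex (H \<times> (UNIV :: real set))"
    using assms by (simp add: convex_on_def convex_Times)
  fix p q :: "('a \<Rightarrow> 'b) \<times> real" and u v :: real
  assume *: "p \<in> H \<times> UNIV" "q \<in> H \<times> UNIV" "0 \<le> u" "0 \<le> v" and uv: "u + v = 1"
  obtain x \<gamma> y \<beta> where pq: "p = (x, \<gamma>)" "q = (y, \<beta>)"
    by (metis surj_pair)
  have cost: "expected_cost h F (u *\<^sub>R x + v *\<^sub>R y) \<le> u * expected_cost h F x + v * expected_cost h F y"
    using assms * uv by (auto simp: convex_on_def pq)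
  have "(1 - (u * \<gamma> + v * \<beta>)) * a + (u * \<gamma> + v * \<beta>) * b
      = u * ((1 - \<gamma>) * a + \<gamma> * b) + v * ((1 - \<beta>) * a + \<beta> * b)" for a b :: real
  proof -
    have "v = 1 - u" using uv by simp
    then show ?thesis by (simp only:) (simp add: algebra_simps)
  qed
  then show "(case u *\<^sub>R p + v *\<^sub>R q of (x, \<gamma>) \<Rightarrow> expected_regret X h F xbar x \<gamma>)
      \<le> u * (case p of (x, \<gamma>) \<Rightarrow> expected_regret X h F xbar x \<gamma>)
        + v * (case q of (x, \<gamma>) \<Rightarrow> expected_regret X h F xbar x \<gamma>)"
    using cost by (simp add: pq expected_regret_def right_diff_distrib)
qed

lemma convex_on_expected_regret_ratio: "convex_on UNIV (expected_regret X h F xbar x)"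
  unfolding convex_on_def
proof (intro conjI ballI allI impI)
  fix \<gamma> \<beta> u v :: real
  assume uv: "u + v = 1"
  have "c - ((1 - (u * \<gamma> + v * \<beta>)) * a + (u * \<gamma> + v * \<beta>) * b)
      = u * (c - ((1 - \<gamma>) * a + \<gamma> * b)) + v * (c - ((1 - \<beta>) * a + \<beta> * b))" for a b c :: real
  proof -
    have "v = 1 - u" using uv by simp
    then show ?thesis by (simp only:) (simp add: algebra_simps)
  qed
  then show "expected_regret X h F xbar x (u *\<^sub>R \<gamma> + v *\<^sub>R \<beta>)
      \<le> u * expected_regret X h F xbar x \<gamma> + v * expected_regret X h F xbar x \<beta>"
    by (simp add: expected_regret_def)
qed simp

lemma mono_expected_regret:
  assumes "expected_min_cost X h F \<le> expected_cost h F (\<lambda>\<zeta>. xbar)"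
  shows "mono (expected_regret X h F xbar x)"
proof (rule monoI)
  fix \<gamma> \<beta> :: real
  assume "\<gamma> \<le> \<beta>"
  then have "0 \<le> (\<beta> - \<gamma>) * (expected_cost h F (\<lambda>\<zeta>. xbar) - expected_min_cost X h F)"
    using assms by simp
  then show "expected_regret X h F xbar x \<gamma> \<le> expected_regret X h F xbar x \<beta>"
    by (simp add: expected_regret_def algebra_simps)
qed

section \<open>The reformulation\<close>

theorem proposition1:
  fixes X :: "(real ^ 'nx) set"
    and h :: "real ^ 'nx \<Rightarrow> real ^ 'ns \<Rightarrow> real"
    and D :: "((real ^ 'nz) \<times> (real ^ 'ns)) measure set"
    and H :: "(real ^ 'nz \<Rightarrow> real ^ 'nx) set"
    and xbar :: "real ^ 'nx"
  assumes "convex X"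
    and "\<And>\<xi>. convex_on X (\<lambda>x. h x \<xi>)"
    and "\<And>\<xi>. \<exists>x\<in>X. \<forall>x'\<in>X. h x \<xi> \<le> h x' \<xi>"
    and "D \<noteq> {}"
    and "\<And>F. F \<in> D \<Longrightarrow> prob_space F \<and> sets F = sets borel"
    and "\<And>x \<zeta>. x \<in> H \<Longrightarrow> x \<zeta> \<in> X"
    and "(\<lambda>\<zeta>. xbar) \<in> H"
    and "\<And>F x. F \<in> D \<Longrightarrow> x \<in> H \<Longrightarrow> integrable F (\<lambda>(\<zeta>, \<xi>). h (x \<zeta>) \<xi>)"
    and "\<And>F. F \<in> D \<Longrightarrow> integrable F (\<lambda>(\<zeta>, \<xi>). min_cost X h \<xi>)"
  shows "(SUP x\<in>H. dr_pcr X h D x xbar)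
           = (SUP (x, \<gamma>)\<in>reform_feasible X h D H xbar. ereal \<gamma>)
       \<and> {x. is_arg_max (\<lambda>x. dr_pcr X h D x xbar) (\<lambda>x. x \<in> H) x}
           = {x. \<exists>\<gamma>. is_arg_max (\<lambda>(x, \<gamma>). \<gamma>) (\<lambda>p. p \<in> reform_feasible X h D H xbar) (x, \<gamma>)}
       \<and> (\<forall>x\<in>H. ereal_convex_on UNIV (worst_regret X h D xbar x)
                 \<and> mono (worst_regret X h D xbar x))
       \<and> (convex H \<longrightarrow>
            linear (\<lambda>(x :: real ^ 'nz \<Rightarrow> real ^ 'nx, \<gamma> :: real). \<gamma>)
          \<and> ereal_convex_on (H \<times> UNIV) (\<lambda>(x, \<gamma>). worst_regret X h D xbar x \<gamma>)
          \<and> convex (reform_feasible X h D H xbar))"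
proof -
  have xbar: "xbar \<in> X"
    using assms(6)[OF assms(7)] .
  have int_bar: "integrable F (\<lambda>(\<zeta>, \<xi>). h xbar \<xi>)" if "F \<in> D" for F
    using assms(8)[OF that assms(7)] .
  have min_le: "expected_min_cost X h F \<le> expected_cost h F x" if "F \<in> D" "x \<in> H" for F x
    using assms(3,6,8,9) that by (intro expected_min_cost_le) auto
  have le1: "dr_pcr X h D x xbar \<le> 1" if "x \<in> H" for x
    using assms(4) min_le that by (intro dr_pcr_le_1) auto
  have bar_nonneg: "0 \<le> dr_pcr X h D (\<lambda>\<zeta>. xbar) xbar"
    unfolding dr_pcr_def using min_le[OF _ assms(7)] by (intro INF_greatest pcr_reference_nonneg)
  have feasible_eq: "reform_feasible X h D H xbar
      = {(x, \<gamma>). x \<in> H \<and> ereal \<gamma> \<le> dr_pcr X h D x xbar \<and> 0 \<le> \<gamma> \<and> \<gamma> \<le> 1}"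
  proof -
    have "ereal \<gamma> \<le> dr_pcr X h D x xbar \<longleftrightarrow> worst_regret X h D xbar x \<gamma> \<le> 0"
      if "x \<in> H" "\<gamma> \<le> 1" for x \<gamma>
      using assms(3,6,8,9) xbar int_bar that by (intro le_dr_pcr_iff_worst_regret) auto
    then show ?thesis
      by (auto simp: reform_feasible_def)
  qed
  have regret_eq: "worst_regret X h D xbar x \<gamma> = (SUP F\<in>D. ereal (expected_regret X h F xbar x \<gamma>))"
    if "x \<in> H" for x \<gamma>
    using assms(8,9) int_bar that by (intro worst_regret_eq_SUP) auto

  have value_eq: "(SUP x\<in>H. dr_pcr X h D x xbar)
      = (SUP (x, \<gamma>)\<in>reform_feasible X h D H xbar. ereal \<gamma>)"
    unfolding feasible_eq
    by (rule SUP_truncated_hypograph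
        [where d="\<lambda>x. dr_pcr X h D x xbar", OF le1 assms(7) bar_nonneg])
  have policies_eq: "{x. is_arg_max (\<lambda>x. dr_pcr X h D x xbar) (\<lambda>x. x \<in> H) x}
      = {x. \<exists>\<gamma>. is_arg_max (\<lambda>(x, \<gamma>). \<gamma>) (\<lambda>p. p \<in> reform_feasible X h D H xbar) (x, \<gamma>)}"
    unfolding feasible_eq
    by (intro Collect_cong arg_max_truncated_hypograph
        [where d="\<lambda>x. dr_pcr X h D x xbar", OF le1 assms(7) bar_nonneg])
  have in_ratio: "ereal_convex_on UNIV (worst_regret X h D xbar x)
      \<and> mono (worst_regret X h D xbar x)" if x: "x \<in> H" for x
  proof
    have *: "worst_regret X h D xbar x = (\<lambda>\<gamma>. SUP F\<in>D. ereal (expected_regret X h F xbar x \<gamma>))"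
      using regret_eq[OF x] by (rule ext)
    show "ereal_convex_on UNIV (worst_regret X h D xbar x)"
      unfolding * by (intro ereal_convex_on_SUP convex_on_expected_regret_ratio convex_UNIV)
    show "mono (worst_regret X h D xbar x)"
      unfolding *
    proof (intro monoI SUP_mono bexI)
      fix \<gamma> \<beta> :: real and F
      assume "\<gamma> \<le> \<beta>" and F: "F \<in> D"
      then show "ereal (expected_regret X h F xbar x \<gamma>) \<le> ereal (expected_regret X h F xbar x \<beta>)"
        using monoD[OF mono_expected_regret[OF min_le[OF F assms(7)]]] by simp
    qed assumption
  qed
  have jointly: "ereal_convex_on (H \<times> UNIV) (\<lambda>(x, \<gamma>). worst_regret X h D xbar x \<gamma>)"
    if H: "convex H"
  proof -
    have "ereal_convex_on (H \<times> UNIV)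
        (\<lambda>p. SUP F\<in>D. ereal ((\<lambda>(x, \<gamma>). expected_regret X h F xbar x \<gamma>) p))"
      using H assms(2,6,8)
      by (intro ereal_convex_on_SUP convex_on_expected_regret convex_on_expected_cost[of X]
            convex_Times) auto
    moreover have "convex (H \<times> (UNIV :: real set))"
      using H by (simp add: convex_Times)
    ultimately show ?thesis
      unfolding ereal_convex_on_def
      by (auto simp: regret_eq convex_def)
  qed
  have feasible_convex: "convex (reform_feasible X h D H xbar)" if H: "convex H"
  proof -
    have "reform_feasible X h D H xbar
        = {p \<in> H \<times> UNIV. (\<lambda>(x, \<gamma>). worst_regret X h D xbar x \<gamma>) p \<le> 0} \<inter> UNIV \<times> {0..1}"
      by (auto simp: reform_feasible_def)
    then show ?thesis
      using convex_nonpos_level_set[OF jointly[OF H]]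
      by (simp add: convex_Int convex_Times)
  qed
  have "linear (\<lambda>(x :: real ^ 'nz \<Rightarrow> real ^ 'nx, \<gamma> :: real). \<gamma>)"
    by (rule linearI) auto
  then show ?thesis
    using value_eq policies_eq in_ratio jointly feasible_convex by blast
qed

end
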